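(* Let $\kappa_*>0$ and $L>0$, and let $H^*$ be a probability measure on $[L,\infty)$. Suppose $X_1,\dots,X_n$ are generated by the hierarchical model $X_i\mid\theta_i\overset{ind}{\sim}\mathrm{Poi}(\theta_i)$, $\theta_i\mid\lambda_i\overset{ind}{\sim}\mathrm{Gamma}(\kappa_*,\lambda_i)$ (shape-rate), $\lambda_i\overset{iid}{\sim}H^*$. Let $\widehat H_n$ be any maximizer $\widehat H_n\in\arg\max_{H\in\mathcal P((0,\infty])}\sum_{i=1}^n\log f_H(X_i)$, and let $X\sim f_{H^*}$ be independent of $\widehat H_n$. Then $$\mathbb E_{H^*}\big[(\hat\theta_{\widehat H_n}(X)-\hat\theta_{H^*}(X))^2\big]\le C\,\frac{(\log n)^3}{n},$$ where $C>0$ depends only on $(\kappa_*,L)$.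
   Context: For $H$ a probability measure on $(0,\infty]$ and $x\in\mathbb Z_+$, $f_H(x)=\int r_{\kappa_*,\lambda}(x)\,dH(\lambda)$ with $r_{\kappa_*,\lambda}(x)=\frac{\Gamma(x+\kappa_* )}{x!\,\Gamma(\kappa_* )}\left(\frac{1}{\lambda+1}\right)^x\left(\frac{\lambda}{\lambda+1}\right)^{\kappa_*}$ for $\lambda<\infty$ and $r_{\kappa_*,\infty}(x)=\mathbf 1(x=0)$. The (empirical) Bayes posterior mean rule is $\hat\theta_H(x)=(x+1)\,f_H(x+1)/f_H(x)$ whenever $f_H(x)>0$ (for $H=H^*$ this is $\mathbb E[\theta_i\mid X_i=x]$). When all observations are zero, so that $\widehat H_n=\delta_\infty$, the convention $\hat\theta_{\widehat H_n}(x)=0$ for all $x$ is used. $\mathcal P(A)$ is the set of probability measures on $A$; $\mathbb E_{H^*}$ is expectation under the model with $\lambda_i\sim H^*$.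
   Formalization: The bound is stated for n ≥ 2, since at n = 1 the right-hand side is 0 while the risk is positive; the observations X_1,…,X_n are taken directly as i.i.d. from the marginal f_{H*} of the hierarchical model. *)

theory Defs
  imports "HOL-Probability.Probability"
begin

text \<open>Mixing parameter lam ranges over (0,\<infinity>], represented in ennreal (top = \<infinity>).
  Negative-binomial kernel r_{kappa,lam}(x); for lam = \<infinity> it is the point mass at 0.\<close>
definition nb_kernel :: "real \<Rightarrow> ennreal \<Rightarrow> nat \<Rightarrow> real" where
  "nb_kernel k l x =
     (if l = \<top> then (if x = 0 then 1 else 0)
      else (let lam = enn2real l in
            Gamma (real x + k) / (fact x * Gamma k) * (1 / (lam + 1)) ^ x
              * (lam / (lam + 1)) powr k))"

definition mix_pmf :: "real \<Rightarrow> ennreal measure \<Rightarrow> nat \<Rightarrow> real" where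
  "mix_pmf k H x = (\<integral>l. nb_kernel k l x \<partial>H)"

text \<open>Bayes rule theta_H(x) = (x+1) f_H(x+1)/f_H(x); set to 0 when f_H(x) = 0
  (this covers the convention for H = delta_infinity).\<close>
definition post_mean :: "real \<Rightarrow> ennreal measure \<Rightarrow> nat \<Rightarrow> real" where
  "post_mean k H x =
     (if mix_pmf k H x > 0 then (real x + 1) * mix_pmf k H (x + 1) / mix_pmf k H x else 0)"

definition prob_on_pos_inf :: "ennreal measure \<Rightarrow> bool" where
  "prob_on_pos_inf H \<longleftrightarrow> prob_space H \<and> sets H = sets borel \<and> emeasure H {0} = 0"

definition loglik :: "real \<Rightarrow> ennreal measure \<Rightarrow> nat \<Rightarrow> (nat \<Rightarrow> nat) \<Rightarrow> ereal" where
  "loglik k H n xs =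
     (\<Sum>i<n. if mix_pmf k H (xs i) > 0 then ereal (ln (mix_pmf k H (xs i))) else -\<infinity>)"

definition is_npmle :: "real \<Rightarrow> nat \<Rightarrow> (nat \<Rightarrow> nat) \<Rightarrow> ennreal measure \<Rightarrow> bool" where
  "is_npmle k n xs H \<longleftrightarrow>
     prob_on_pos_inf H \<and> (\<forall>H'. prob_on_pos_inf H' \<longrightarrow> loglik k H' n xs \<le> loglik k H n xs)"

text \<open>Regret E_{H*}[(theta_{Hhat_n}(X) - theta_{H*}(X))^2]: the sample X_1..X_n is iid
  with pmf f_{H*}, X ~ f_{H*} independent of the sample; Hhat maps a sample to an estimate.\<close>
definition npmle_risk ::
  "real \<Rightarrow> nat \<Rightarrow> ennreal measure \<Rightarrow> ((nat \<Rightarrow> nat) \<Rightarrow> ennreal measure) \<Rightarrow> ennreal" where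
  "npmle_risk k n Hs Hhat =
     (\<integral>\<^sup>+ xs. (\<Prod>i<n. ennreal (mix_pmf k Hs (xs i))) *
        (\<integral>\<^sup>+ x. ennreal (mix_pmf k Hs x) *
             ennreal ((post_mean k (Hhat xs) x - post_mean k Hs x)\<^sup>2) \<partial>count_space UNIV)
      \<partial>count_space ({..<n} \<rightarrow>\<^sub>E (UNIV :: nat set)))"

end

(*
  Write f for the true mixture mass function, g for the fitted one, and p for the empirical
  one.  Since ln t <= 2 (sqrt t - 1), maximality of the likelihood gives
  sum p sqrt (g / f) >= 1 (sum over the sample values), and termwise AM-GM turns this into
  H^2(g, f) <= 4 chi^2(p, f) up to the mass of f beyond a cutoff K.  The expectation of the chi^2
  statistic restricted to {0..K} is at most (K + 1) / n.

  Every posterior mean at x lies in [0, x + k], because (x + 1) r(x + 1) <= (x + k) r(x) for every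
  kernel r.  This bounds the regret below K by O((K + k)^2) H^2(g, f).  As the rates are at least
  L, the tails of f are geometric, so K of order ln n makes everything beyond K negligible and
  leaves (ln n)^3 / n.
*)
theory Submission
  imports Defs
begin

section \<open>Negative binomial mixtures\<close>

text \<open>This is the binomial series with exponent \<open>- k\<close> at \<open>- z\<close>,
  where the alternating signs cancel.\<close>

lemma pochhammer_series:
  fixes k z :: real
  assumes "\<bar>z\<bar> < 1"
  shows "(\<lambda>x. pochhammer k x / fact x * z ^ x) sums (1 - z) powr (- k)"
proof -
  have "((- k) gchoose x) * (- z) ^ x = pochhammer k x / fact x * z ^ x" for x
  proof -
    have "(- 1) ^ x * (- z) ^ x = z ^ x" by (simp flip: power_mult_distrib)
    then show ?thesis by (simp add: gbinomial_pochhammer mult_ac)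
  qed
  with gen_binomial_real[of "- z" "- k"] assms show ?thesis by simp
qed

text \<open>Absorbs the quadratic moment weight of the regret into a negative binomial series of shape $k + 2$.\<close>
lemma pochhammer_shift_two:
  fixes k :: real
  shows "(k + real x) * (k + real x + 1) * pochhammer k x = k * (k + 1) * pochhammer (k + 2) x"
proof -
  have two: "pochhammer a 2 = a * (a + 1)" for a :: real
    using pochhammer_rec'[of a 1] by (simp add: numeral_2_eq_2 mult.commute)
  have "pochhammer k x * pochhammer (k + real x) 2 = pochhammer k (2 + x)"
    using pochhammer_product'[of k x 2] by (simp only: add.commute)
  also have "\<dots> = pochhammer k 2 * pochhammer (k + 2) x"
    using pochhammer_product'[of k 2 x] by (simp only: of_nat_numeral)
  finally show ?thesis
    unfolding two by (simp only: mult.commute mult.left_commute)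
qed

section \<open>The negative binomial kernel\<close>

lemma nb_kernel_finite:
  assumes "k > 0" "l \<noteq> \<top>"
  shows "nb_kernel k l x = pochhammer k x / fact x * (1 / (enn2real l + 1)) ^ x
           * (enn2real l / (enn2real l + 1)) powr k"
proof -
  \<comment> \<open>Positivity of \<open>k\<close> keeps Gamma away from its poles, so the quotient
    becomes a Pochhammer symbol, whose series has a closed form.\<close>
  have "Gamma k \<noteq> 0" using assms by (metis Gamma_real_pos less_irrefl)
  moreover have "k \<notin> \<int>\<^sub>\<le>\<^sub>0" using assms by (auto simp: nonpos_Ints_def)
  ultimately have "Gamma (real x + k) / (fact x * Gamma k) = pochhammer k x / fact x"
    by (simp add: pochhammer_Gamma add.commute)
  then show ?thesis using assms by (simp add: nb_kernel_def Let_def)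
qed

lemma nb_kernel_top [simp]: "nb_kernel k \<top> x = (if x = 0 then 1 else 0)"
  by (simp add: nb_kernel_def)

lemma nb_kernel_nonneg:
  assumes "k > 0" shows "nb_kernel k l x \<ge> 0"
proof (cases "l = \<top>")
  case False
  show ?thesis unfolding nb_kernel_finite[OF assms False]
    using assms by (intro mult_nonneg_nonneg zero_le_power) (auto simp: pochhammer_nonneg)
qed simp

lemma enn2real_pos_finite: "l \<noteq> 0 \<Longrightarrow> l \<noteq> \<top> \<Longrightarrow> enn2real l > 0"
  by (simp add: enn2real_positive_iff less_top zero_less_iff_neq_zero)

lemma nb_kernel_pos:
  assumes "k > 0" "l \<noteq> 0" "l \<noteq> \<top>" shows "nb_kernel k l x > 0"
  using assms enn2real_pos_finite[of l]
  by (simp add: nb_kernel_finite pochhammer_pos add_pos_pos)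

text \<open>The factor \<open>(t / (t + 1)) powr k\<close> is the reciprocal of the binomial series
  at \<open>1 / (t + 1)\<close>.\<close>

lemma nb_kernel_sums:
  assumes "k > 0" "l \<noteq> 0" shows "nb_kernel k l sums 1"
proof (cases "l = \<top>")
  case True
  have "nb_kernel k l = (\<lambda>x. if x = 0 then 1 else 0)" using True by auto
  then show ?thesis using sums_single[of 0 "\<lambda>_. 1::real"] by simp
next
  case False
  define t where "t = enn2real l"
  have t: "t > 0" using enn2real_pos_finite[OF assms(2) False] by (simp add: t_def)
  have e: "1 - 1 / (t + 1) = t / (t + 1)" using t by (simp add: field_simps)
  have "(\<lambda>x. pochhammer k x / fact x * (1 / (t + 1)) ^ x * (t / (t + 1)) powr k) sums
      ((1 - 1 / (t + 1)) powr (- k) * (t / (t + 1)) powr k)"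
    using t by (intro sums_mult2 pochhammer_series) simp
  also have "(1 - 1 / (t + 1)) powr (- k) * (t / (t + 1)) powr k = 1"
    using t unfolding e by (simp add: powr_minus)
  finally show ?thesis
    using nb_kernel_finite[OF assms(1) False] by (simp only: sums_def t_def)
qed

text \<open>Here \<open>0 powr k = 0\<close>; covering this excluded rate lets the bound by 1 hold
  at every point of \<open>ennreal\<close>.\<close>

lemma nb_kernel_0:
  assumes "k > 0" shows "nb_kernel k 0 x = 0"
  using assms by (simp add: nb_kernel_finite)

lemma nb_kernel_le_1:
  assumes "k > 0" shows "nb_kernel k l x \<le> 1"
proof (cases "l = 0")
  case False
  have "(\<Sum>y\<in>{x}. nb_kernel k l y) \<le> 1"
    using sum_le_suminf[of "nb_kernel k l" "{x}"] nb_kernel_sums[OF assms False] nb_kernel_nonneg[OF assms]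
    by (simp add: sums_iff)
  then show ?thesis by simp
qed (simp add: nb_kernel_0 assms)

text \<open>At a finite rate \<open>t > 0\<close> consecutive values have ratio
  \<open>(x + k) / ((x + 1) * (t + 1))\<close>, and \<open>1 / (t + 1) \<le> 1\<close>. Being linear
  in the kernel, the inequality survives mixing.\<close>

lemma nb_kernel_Suc_le:
  assumes "k > 0"
  shows "(real x + 1) * nb_kernel k l (Suc x) \<le> (real x + k) * nb_kernel k l x"
proof (cases "l = \<top>")
  case False
  define t where "t = enn2real l"
  have t: "t \<ge> 0" by (simp add: t_def)
  have "pochhammer k (Suc x) / fact (Suc x) * (1 / (t + 1)) ^ Suc x * (real x + 1) =
    (real x + k) * (pochhammer k x / fact x * (1 / (t + 1)) ^ x) * (1 / (t + 1))"
    using t by (simp add: pochhammer_rec' divide_simps) (simp add: algebra_simps)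
  then have "(real x + 1) * nb_kernel k l (Suc x) = (real x + k) * nb_kernel k l x * (1 / (t + 1))"
    unfolding nb_kernel_finite[OF assms False] t_def[symmetric]
    by (simp only: mult.assoc[symmetric] mult.commute[of "real x + 1"])
      (simp only: mult.assoc mult.commute mult.left_commute)
  also have "\<dots> \<le> (real x + k) * nb_kernel k l x"
    using t assms nb_kernel_nonneg[OF assms, of l x] by (intro mult_right_le_one_le) auto
  finally show ?thesis .
qed (use assms in simp)

text \<open>The normalizing power is at most 1, and the base \<open>1 / (t + 1)\<close> decreases in
  the rate.\<close>

lemma nb_kernel_le_geometric:
  assumes "k > 0" "L > 0" "ennreal L \<le> l" "l \<noteq> \<top>"
  shows "nb_kernel k l x \<le> pochhammer k x / fact x * (1 / (L + 1)) ^ x"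
proof -
  define t where "t = enn2real l"
  have "enn2real (ennreal L) \<le> t"
    unfolding t_def using assms by (intro enn2real_mono) (auto simp: less_top)
  then have t: "t \<ge> L" using assms by simp
  have "(t / (t + 1)) powr k \<le> 1"
    using t assms by (intro powr_le1) auto
  then have "nb_kernel k l x \<le> pochhammer k x / fact x * (1 / (t + 1)) ^ x"
    unfolding nb_kernel_finite[OF assms(1,4)] t_def[symmetric]
    using t assms by (intro mult_right_le_one_le mult_nonneg_nonneg) (auto simp: pochhammer_nonneg)
  also have "\<dots> \<le> pochhammer k x / fact x * (1 / (L + 1)) ^ x"
    using t assms by (intro mult_left_mono power_mono) (auto simp: pochhammer_nonneg frac_le)
  finally show ?thesis .
qed

lemma nb_kernel_measurable [measurable]: "(\<lambda>l. nb_kernel k l x) \<in> borel_measurable borel"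
  unfolding nb_kernel_def Let_def by measurable

lemma integrable_nb_kernel:
  assumes "k > 0" "prob_space H" "sets H = sets borel"
  shows "integrable H (\<lambda>l. nb_kernel k l x)"
proof -
  interpret prob_space H by fact
  have [measurable_cong]: "sets H = sets borel" by fact
  show ?thesis
    using assms nb_kernel_le_1[of k] nb_kernel_nonneg[of k]
    by (intro integrable_const_bound[where B = 1]) auto
qed

section \<open>Mixture mass functions and posterior means\<close>

lemma mix_pmf_nonneg: "k > 0 \<Longrightarrow> mix_pmf k H x \<ge> 0"
  unfolding mix_pmf_def by (intro integral_nonneg_AE) (simp add: nb_kernel_nonneg)

lemma mix_pmf_Suc_le:
  assumes "k > 0" "prob_space H" "sets H = sets borel"
  shows "(real x + 1) * mix_pmf k H (Suc x) \<le> (real x + k) * mix_pmf k H x"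
proof -
  have "(real x + 1) * mix_pmf k H (Suc x) = (\<integral>l. (real x + 1) * nb_kernel k l (Suc x) \<partial>H)"
    by (simp add: mix_pmf_def)
  also have "\<dots> \<le> (\<integral>l. (real x + k) * nb_kernel k l x \<partial>H)"
    by (intro integral_mono integrable_mult_right integrable_nb_kernel nb_kernel_Suc_le assms)
  finally show ?thesis by (simp add: mix_pmf_def)
qed

text \<open>Tonelli in \<open>ennreal\<close> exchanges sum and integral first; summability over the
  reals is read off from the finite value.\<close>

lemma mix_pmf_sums:
  assumes "k > 0" "prob_on_pos_inf H"
  shows "mix_pmf k H sums 1"
proof -
  have H: "prob_space H" and s [measurable_cong]: "sets H = sets borel" and z: "emeasure H {0} = 0"
    using assms(2) by (auto simp: prob_on_pos_inf_def)
  interpret prob_space H by fact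
  \<comment> \<open>At rate 0 the kernel sums to 0 instead of 1, so that rate must carry no
    mass.\<close>
  have ne: "AE l in H. l \<noteq> 0"
    using z s by (intro AE_I[where N = "{0}"]) auto
  have e: "ennreal (mix_pmf k H x) = (\<integral>\<^sup>+l. ennreal (nb_kernel k l x) \<partial>H)" for x
    unfolding mix_pmf_def
    by (intro nn_integral_eq_integral[symmetric] integrable_nb_kernel assms H s)
      (simp add: nb_kernel_nonneg assms)
  have "(\<Sum>x. ennreal (mix_pmf k H x)) = (\<integral>\<^sup>+l. (\<Sum>x. ennreal (nb_kernel k l x)) \<partial>H)"
    unfolding e by (intro nn_integral_suminf[symmetric]) measurable
  also have "\<dots> = (\<integral>\<^sup>+l. 1 \<partial>H)"
    using ne by (intro nn_integral_cong_AE)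
      (auto elim!: eventually_mono
        dest!: suminf_ennreal_eq[OF nb_kernel_nonneg[OF assms(1)] nb_kernel_sums[OF assms(1)]])
  finally have s1: "(\<Sum>x. ennreal (mix_pmf k H x)) = 1" by (simp add: emeasure_space_1)
  then have sm: "summable (mix_pmf k H)"
    by (intro summable_suminf_not_top mix_pmf_nonneg assms) simp
  have "ennreal (\<Sum>x. mix_pmf k H x) = 1"
    using suminf_ennreal2[OF mix_pmf_nonneg[OF assms(1)] sm] s1 by simp
  then show ?thesis using sm
    by (metis ennreal_eq_1 summable_sums)
qed

text \<open>A nonnegative integrand with integral 0 vanishes almost everywhere, but at finite
  positive rates the kernel is strictly positive.\<close>

lemma mix_pmf_pos:
  assumes "k > 0" "prob_space H" "sets H = sets borel" "AE l in H. l \<noteq> 0 \<and> l \<noteq> \<top>"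
  shows "mix_pmf k H x > 0"
proof (rule ccontr)
  assume "\<not> ?thesis"
  then have "mix_pmf k H x = 0" using mix_pmf_nonneg[OF assms(1), of H x] by linarith
  then have "AE l in H. nb_kernel k l x = 0"
    unfolding mix_pmf_def
    using integral_nonneg_eq_0_iff_AE[OF integrable_nb_kernel[OF assms(1-3)]]
      nb_kernel_nonneg[OF assms(1)] by simp
  with assms(4) have "AE l in H. False"
    by eventually_elim (metis nb_kernel_pos[OF assms(1)] less_irrefl)
  then show False using prob_space.AE_False[OF assms(2)] by simp
qed

lemma mix_pmf_le_geometric:
  assumes "k > 0" "L > 0" "prob_space H" "sets H = sets borel" "AE l in H. ennreal L \<le> l \<and> l \<noteq> \<top>"
  shows "mix_pmf k H x \<le> pochhammer k x / fact x * (1 / (L + 1)) ^ x"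
proof -
  interpret prob_space H by fact
  have "mix_pmf k H x \<le> (\<integral>l. pochhammer k x / fact x * (1 / (L + 1)) ^ x \<partial>H)"
    unfolding mix_pmf_def
  proof (intro integral_mono_AE integrable_nb_kernel assms)
    show "AE l in H. nb_kernel k l x \<le> pochhammer k x / fact x * (1 / (L + 1)) ^ x"
      using assms(5) by eventually_elim (use nb_kernel_le_geometric[OF assms(1,2)] in blast)
  qed simp
  then show ?thesis by (simp add: prob_space)
qed

text \<open>Division by zero gives 0, which agrees with the default value in
  \<open>post_mean\<close>.\<close>

lemma post_mean_eq: "k > 0 \<Longrightarrow> post_mean k H x = (real x + 1) * mix_pmf k H (Suc x) / mix_pmf k H x"
  using mix_pmf_nonneg[of k H x] by (auto simp: post_mean_def)

lemma post_mean_bounds: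
  assumes "k > 0" "prob_space H" "sets H = sets borel"
  shows "0 \<le> post_mean k H x" "post_mean k H x \<le> real x + k"
  using mix_pmf_Suc_le[OF assms, of x] mix_pmf_nonneg[OF assms(1)] assms(1)
  by (auto simp: post_mean_def divide_le_eq mult_ac)

section \<open>Regret and Hellinger distance\<close>

text \<open>To be used with \<open>m = x + 1\<close> and \<open>M = x + k\<close>, where
  \<open>a\<close>, \<open>a'\<close> are the true masses at \<open>x\<close> and
  \<open>x + 1\<close>, and \<open>b\<close>, \<open>b'\<close> the fitted ones.\<close>

lemma regret_pointwise_le:
  fixes a b a' b' m M :: real
  assumes "a > 0" "b \<ge> 0" "a' \<ge> 0" "b' \<ge> 0" "m > 0" "m * a' \<le> M * a" "m * b' \<le> M * b"
  shows "a * (m * b' / b - m * a' / a)\<^sup>2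
    \<le> 16 * (m * M * (sqrt b' - sqrt a')\<^sup>2 + M\<^sup>2 * (sqrt b - sqrt a)\<^sup>2)"
proof -
  define s t where "s = m * a' / a" and "t = m * b' / b"
  \<comment> \<open>Factor \<open>v - u\<close> through the square roots; AM-GM bounds the square of
    \<open>sqrt v + sqrt u\<close>.\<close>
  have sqdiff: "(v - u)\<^sup>2 \<le> 2 * (u + v) * (sqrt v - sqrt u)\<^sup>2" if "u \<ge> 0" "v \<ge> 0" for u v :: real
  proof -
    have "(v - u)\<^sup>2 = (sqrt v + sqrt u)\<^sup>2 * (sqrt v - sqrt u)\<^sup>2"
      using that by (simp add: power_mult_distrib[symmetric] algebra_simps)
    also have "(sqrt v + sqrt u)\<^sup>2 \<le> 2 * (u + v)"
      using that arith_geo_mean_sqrt[of u v] by (simp add: power2_sum real_sqrt_mult mult_ac)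
    finally show ?thesis by (simp add: mult_right_mono)
  qed
  have sq: "(u + v)\<^sup>2 \<le> 2 * u\<^sup>2 + 2 * v\<^sup>2" for u v :: real
    using zero_le_power2[of "u - v"] unfolding power2_sum power2_diff by linarith
  have "0 \<le> m * a'" using assms by simp
  then have "0 \<le> M * a" using assms by linarith
  then have M: "M \<ge> 0" using assms by (simp add: zero_le_mult_iff)
  have sb: "0 \<le> s" "s \<le> M" using assms by (auto simp: s_def divide_le_eq)
  have tb: "0 \<le> t" "t \<le> M" using assms M by (auto simp: t_def divide_le_eq)
  have sa: "s * a = m * a'" using assms by (simp add: s_def)
  \<comment> \<open>If \<open>b = 0\<close>, then \<open>m * b' \<le> M * b\<close> forces
    \<open>b' = 0\<close>, so the default quotient 0 is consistent.\<close>
  have tb': "t * b = m * b'"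
  proof (cases "b = 0")
    case True
    then have "b' = 0" using assms by (simp add: mult_le_0_iff)
    then show ?thesis using True by simp
  qed (simp add: t_def)
  \<comment> \<open>Symmetric in the two mixtures: a version divided by \<open>a\<close> alone would leave the unbounded ratio \<open>b / a\<close>.\<close>
  have "(t - s) * (a + b) = 2 * (m * b' - m * a') + (t + s) * (a - b)"
    using sa tb' by (simp add: algebra_simps)
  then have "((t - s) * (a + b))\<^sup>2 = (2 * (m * b' - m * a') + (t + s) * (a - b))\<^sup>2" by simp
  also have "\<dots> \<le> 2 * (2 * (m * b' - m * a'))\<^sup>2 + 2 * ((t + s) * (a - b))\<^sup>2"
    by (rule sq)
  also have "\<dots> = 8 * (m\<^sup>2 * (b' - a')\<^sup>2) + 2 * ((t + s)\<^sup>2 * (b - a)\<^sup>2)"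
    by (simp add: power2_eq_square algebra_simps)
  also have "(t + s)\<^sup>2 \<le> (2 * M)\<^sup>2" using sb tb by (intro power_mono) auto
  then have "8 * (m\<^sup>2 * (b' - a')\<^sup>2) + 2 * ((t + s)\<^sup>2 * (b - a)\<^sup>2) \<le>
      8 * (m\<^sup>2 * (2 * (a' + b') * (sqrt b' - sqrt a')\<^sup>2))
      + 2 * ((2 * M)\<^sup>2 * (2 * (a + b) * (sqrt b - sqrt a)\<^sup>2))"
    using assms by (intro add_mono mult_left_mono mult_mono sqdiff) auto
  also have "\<dots> = 16 * m * (m * a' + m * b') * (sqrt b' - sqrt a')\<^sup>2
      + 16 * (a + b) * M\<^sup>2 * (sqrt b - sqrt a)\<^sup>2"
    by (simp add: power2_eq_square algebra_simps)
  \<comment> \<open>The ratio bounds turn the shifted masses \<open>a'\<close>, \<open>b'\<close>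
    into \<open>M * (a + b)\<close>, so every term carries the factor \<open>a + b\<close>.\<close>
  also have "\<dots> \<le> 16 * m * (M * a + M * b) * (sqrt b' - sqrt a')\<^sup>2
      + 16 * (a + b) * M\<^sup>2 * (sqrt b - sqrt a)\<^sup>2"
    using assms by (intro add_right_mono mult_right_mono mult_left_mono) auto
  finally have main: "((t - s) * (a + b))\<^sup>2 \<le>
     (a + b) * (16 * (m * M * (sqrt b' - sqrt a')\<^sup>2 + M\<^sup>2 * (sqrt b - sqrt a)\<^sup>2))"
    by (simp add: algebra_simps)
  \<comment> \<open>Enlarge the weight \<open>a\<close> to \<open>a + b\<close>, then cancel one
    factor \<open>a + b\<close> from \<open>main\<close>.\<close>
  have "a * (t - s)\<^sup>2 \<le> (a + b) * (t - s)\<^sup>2" using assms by (intro mult_right_mono) auto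
  moreover have "(a + b) * ((a + b) * (t - s)\<^sup>2)
      \<le> (a + b) * (16 * (m * M * (sqrt b' - sqrt a')\<^sup>2 + M\<^sup>2 * (sqrt b - sqrt a)\<^sup>2))"
    using main by (simp add: power2_eq_square mult_ac)
  then have "(a + b) * (t - s)\<^sup>2 \<le> 16 * (m * M * (sqrt b' - sqrt a')\<^sup>2 + M\<^sup>2 * (sqrt b - sqrt a)\<^sup>2)"
    by (rule mult_left_le_imp_le) (use assms in linarith)
  ultimately show ?thesis unfolding s_def t_def by linarith
qed

text \<open>Comparing the \<open>p\<close>-average of \<open>sqrt (b / a)\<close> with its
  \<open>a\<close>-average pairs \<open>(p - a) / sqrt a\<close> with
  \<open>sqrt b - sqrt a\<close>; AM-GM splits the product into a chi-square and a Hellinger part.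
  The last term accounts for the mass that \<open>a\<close> lacks on \<open>S\<close>.\<close>

lemma hellinger_le_chi_square:
  fixes a b p :: "'a \<Rightarrow> real"
  assumes "\<And>x. x \<in> S \<Longrightarrow> a x > 0" "\<And>x. x \<in> S \<Longrightarrow> b x \<ge> 0"
    and "sum p S = 1" "sum b S \<le> 1" "(\<Sum>x\<in>S. p x * sqrt (b x / a x)) \<ge> 1"
  shows "(\<Sum>x\<in>S. (sqrt (b x) - sqrt (a x))\<^sup>2) \<le> 4 * (\<Sum>x\<in>S. (p x - a x)\<^sup>2 / a x) + 2 * (1 - sum a S)"
proof -
  define h where "h x = (sqrt (b x) - sqrt (a x))\<^sup>2" for x
  have pw: "p x * sqrt (b x / a x) - p x - (b x - a x - h x) / 2 \<le> (p x - a x)\<^sup>2 / a x + h x / 4"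
    if "x \<in> S" for x
  proof -
    define r s where "r = sqrt (a x)" and "s = sqrt (b x)"
    have r: "r > 0" "a x = r\<^sup>2" and s: "s \<ge> 0" "b x = s\<^sup>2"
      using assms(1,2)[OF that] by (auto simp: r_def s_def less_imp_le)
    \<comment> \<open>The left side of \<open>pw\<close> is \<open>u * (s - r)\<close>, because
      \<open>(b - a - h) / 2 = r * (s - r)\<close>. AM-GM is weighted to give \<open>h / 4\<close>,
      so half of the \<open>h / 2\<close> on the left survives; hence the factor 4.\<close>
    define u where "u = (p x - r\<^sup>2) / r"
    have "u * (s - r) \<le> u\<^sup>2 + (s - r)\<^sup>2 / 4"
      using zero_le_power2[of "u - (s - r) / 2"] by (simp add: power2_diff power_divide)
    moreover have "u * (s - r) = p x * (s / r) - p x - (s\<^sup>2 - r\<^sup>2 - (s - r)\<^sup>2) / 2"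
      using r by (simp add: u_def field_simps power2_eq_square)
    moreover have "u\<^sup>2 = (p x - r\<^sup>2)\<^sup>2 / r\<^sup>2" by (simp add: u_def power_divide)
    ultimately show ?thesis
      using r s by (simp add: h_def real_sqrt_divide)
  qed
  have "(\<Sum>x\<in>S. p x * sqrt (b x / a x) - p x - (b x - a x - h x) / 2)
      \<le> (\<Sum>x\<in>S. (p x - a x)\<^sup>2 / a x + h x / 4)"
    by (intro sum_mono pw)
  then have "(\<Sum>x\<in>S. p x * sqrt (b x / a x)) - 1 - (sum b S - sum a S - sum h S) / 2
     \<le> (\<Sum>x\<in>S. (p x - a x)\<^sup>2 / a x) + sum h S / 4"
    by (simp add: sum_subtractf sum.distrib assms(3) flip: sum_divide_distrib)
  then show ?thesis using assms(4,5) unfolding h_def by (simp add: field_simps)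
qed

section \<open>Likelihood comparison for the maximizer\<close>

definition empirical :: "nat \<Rightarrow> (nat \<Rightarrow> nat) \<Rightarrow> nat \<Rightarrow> real" where
  "empirical n xs x = (\<Sum>i<n. of_bool (xs i = x)) / real n"

lemma sum_empirical:
  assumes "\<And>i. i < n \<Longrightarrow> xs i \<le> K"
  shows "(\<Sum>x\<le>K. empirical n xs x * g x) = (\<Sum>i<n. g (xs i)) / real n"
proof -
  have "(\<Sum>x\<le>K. empirical n xs x * g x) = (\<Sum>x\<le>K. \<Sum>i<n. of_bool (xs i = x) * g x / real n)"
    by (simp only: empirical_def sum_distrib_right sum_divide_distrib times_divide_eq_left)
  also have "\<dots> = (\<Sum>i<n. \<Sum>x\<le>K. of_bool (xs i = x) * g x / real n)"
    by (rule sum.swap)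
  also have "\<dots> = (\<Sum>i<n. g (xs i) / real n)"
  proof (intro sum.cong refl)
    fix i assume "i \<in> {..<n}"
    then have "xs i \<in> {..K}" using assms by simp
    moreover have "of_bool (xs i = x) * g x / real n = (if x = xs i then g x / real n else 0)" for x
      by simp
    ultimately show "(\<Sum>x\<le>K. of_bool (xs i = x) * g x / real n) = g (xs i) / real n"
      by (simp only: sum.delta finite_atMost if_True)
  qed
  finally show ?thesis by (simp add: sum_divide_distrib)
qed

text \<open>In \<open>ereal\<close> the sum of \<open>\<infinity>\<close> and
  \<open>- \<infinity>\<close> is \<open>\<infinity>\<close>, so the other summands have to avoid
  \<open>\<infinity>\<close>.\<close>

lemma ereal_sum_eq_MInf:
  fixes f :: "'a \<Rightarrow> ereal"
  assumes "finite A" "i \<in> A" "f i = - \<infinity>" "\<And>j. j \<in> A \<Longrightarrow> f j \<noteq> \<infinity>"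
  shows "sum f A = - \<infinity>"
proof -
  have "sum f (A - {i}) \<noteq> \<infinity>" using assms by (subst sum_Pinfty) auto
  then show ?thesis
    using assms by (subst sum.remove[of A i]) (cases "sum f (A - {i})", auto)
qed

text \<open>The competitor has finite log-likelihood, so the maximizer has no term
  \<open>- \<infinity>\<close>; both sums are then real and can be compared.\<close>

lemma npmle_likelihood:
  assumes "is_npmle k n xs H" "prob_on_pos_inf H'" "\<And>i. i < n \<Longrightarrow> mix_pmf k H' (xs i) > 0"
  shows "\<And>i. i < n \<Longrightarrow> mix_pmf k H (xs i) > 0"
    and "(\<Sum>i<n. ln (mix_pmf k H' (xs i))) \<le> (\<Sum>i<n. ln (mix_pmf k H (xs i)))"
proof -
  have le: "loglik k H' n xs \<le> loglik k H n xs"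
    using assms by (auto simp: is_npmle_def)
  have e: "loglik k H' n xs = ereal (\<Sum>i<n. ln (mix_pmf k H' (xs i)))"
    using assms(3) by (simp add: loglik_def flip: sum_ereal)
  show pos: "mix_pmf k H (xs i) > 0" if "i < n" for i
  proof (rule ccontr)
    assume "\<not> ?thesis"
    then have "loglik k H n xs = - \<infinity>"
      unfolding loglik_def using that by (intro ereal_sum_eq_MInf[of _ i]) auto
    then show False using le e by simp
  qed
  have "loglik k H n xs = ereal (\<Sum>i<n. ln (mix_pmf k H (xs i)))"
    using pos by (simp add: loglik_def flip: sum_ereal)
  then show "(\<Sum>i<n. ln (mix_pmf k H' (xs i))) \<le> (\<Sum>i<n. ln (mix_pmf k H (xs i)))"
    using le e by simp
qed

lemma sum_sqrt_likelihood_ratio_ge: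
  fixes a b :: "nat \<Rightarrow> real"
  assumes "\<And>i. i < n \<Longrightarrow> a i > 0" "\<And>i. i < n \<Longrightarrow> b i > 0" "(\<Sum>i<n. ln (a i)) \<le> (\<Sum>i<n. ln (b i))"
  shows "real n \<le> (\<Sum>i<n. sqrt (b i / a i))"
proof -
  \<comment> \<open>The square root of the ratio is what \<open>ln_le_minus_one\<close> is applied
    to; this halves the logarithm.\<close>
  have "1 + (ln (b i) - ln (a i)) / 2 \<le> sqrt (b i / a i)" if "i < n" for i
    using ln_le_minus_one[of "sqrt (b i / a i)"] assms(1,2)[OF that]
    by (simp add: ln_sqrt ln_div field_simps)
  then have "(\<Sum>i<n. 1 + (ln (b i) - ln (a i)) / 2) \<le> (\<Sum>i<n. sqrt (b i / a i))"
    by (intro sum_mono) auto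
  then have "real n + ((\<Sum>i<n. ln (b i)) - (\<Sum>i<n. ln (a i))) / 2 \<le> (\<Sum>i<n. sqrt (b i / a i))"
    by (simp add: sum.distrib sum_subtractf flip: sum_divide_distrib)
  moreover have "0 \<le> ((\<Sum>i<n. ln (b i)) - (\<Sum>i<n. ln (a i))) / 2" using assms(3) by simp
  ultimately show ?thesis by (meson le_add_same_cancel1 order_trans)
qed

text \<open>When the cutoff covers the sample, \<open>empirical\<close> is a probability on
  \<open>{..K}\<close>. The truth is to serve as the competitor \<open>H'\<close>.\<close>

lemma npmle_hellinger_le:
  assumes k: "k > 0" and n: "n > 0" and H: "is_npmle k n xs H" and H': "prob_on_pos_inf H'"
    and pos: "\<And>x. mix_pmf k H' x > 0" and K: "\<And>i. i < n \<Longrightarrow> xs i \<le> K"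
  shows "(\<Sum>x\<le>K. (sqrt (mix_pmf k H x) - sqrt (mix_pmf k H' x))\<^sup>2)
    \<le> 4 * (\<Sum>x\<le>K. (empirical n xs x - mix_pmf k H' x)\<^sup>2 / mix_pmf k H' x)
      + 2 * (1 - (\<Sum>x\<le>K. mix_pmf k H' x))"
proof (intro hellinger_le_chi_square pos mix_pmf_nonneg k)
  show "sum (empirical n xs) {..K} = 1"
    using sum_empirical[of n xs K "\<lambda>_. 1"] K n by simp
  have "prob_on_pos_inf H" using H by (simp add: is_npmle_def)
  then show "sum (mix_pmf k H) {..K} \<le> 1"
    using mix_pmf_sums[OF k, of H] sum_le_suminf[of "mix_pmf k H" "{..K}"] mix_pmf_nonneg[OF k]
    by (simp add: sums_iff)
  have "real n \<le> (\<Sum>i<n. sqrt (mix_pmf k H (xs i) / mix_pmf k H' (xs i)))"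
    using npmle_likelihood[OF H H' pos] by (intro sum_sqrt_likelihood_ratio_ge pos) auto
  then show "1 \<le> (\<Sum>x\<le>K. empirical n xs x * sqrt (mix_pmf k H x / mix_pmf k H' x))"
    using n sum_empirical[of n xs K "\<lambda>x. sqrt (mix_pmf k H x / mix_pmf k H' x)"] K
    by (simp add: le_divide_eq)
qed

section \<open>Second moments of the empirical distribution\<close>

lemma Pi_pmf_marginal_expectation:
  fixes g :: "'b \<Rightarrow> real"
  assumes "finite A" "i \<in> A"
  shows "measure_pmf.expectation (Pi_pmf A d (\<lambda>_. p)) (\<lambda>xs. g (xs i)) = measure_pmf.expectation p g"
proof -
  have "measure_pmf.expectation p g
      = measure_pmf.expectation (map_pmf (\<lambda>xs. xs i) (Pi_pmf A d (\<lambda>_. p))) g"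
    using assms by (simp add: Pi_pmf_component)
  then show ?thesis by simp
qed

text \<open>Independence and centring remove the off-diagonal products; the bound \<open>B\<close>
  supplies integrability.\<close>

lemma Pi_pmf_sum_second_moment:
  fixes Y :: "'b \<Rightarrow> real"
  assumes A: "finite A" and bd: "\<And>x. \<bar>Y x\<bar> \<le> B" and 0: "measure_pmf.expectation p Y = 0"
  shows "measure_pmf.expectation (Pi_pmf A d (\<lambda>_. p)) (\<lambda>xs. (\<Sum>i\<in>A. Y (xs i))\<^sup>2)
    = real (card A) * measure_pmf.expectation p (\<lambda>x. (Y x)\<^sup>2)"
proof -
  let ?P = "Pi_pmf A d (\<lambda>_. p)"
  note ps = prob_space_measure_pmf[of ?P]
  have B: "0 \<le> B" using bd abs_ge_zero order_trans by blast
  have int: "integrable (measure_pmf ?P) (\<lambda>xs. Y (xs i) * Y (xs j))" for i j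
    using B bd by (intro measure_pmf.integrable_const_bound[where B = "B * B"])
      (auto simp: abs_mult intro!: mult_mono)
  have int1: "integrable (measure_pmf ?P) (\<lambda>xs. Y (xs i))" for i
    using bd by (intro measure_pmf.integrable_const_bound[where B = B]) auto
  have cross: "measure_pmf.expectation ?P (\<lambda>xs. Y (xs i) * Y (xs j))
      = (if j = i then measure_pmf.expectation p (\<lambda>x. (Y x)\<^sup>2) else 0)"
    if ij: "i \<in> A" "j \<in> A" for i j
  proof (cases "j = i")
    case True
    then show ?thesis
      using Pi_pmf_marginal_expectation[OF A ij(1), of d p "\<lambda>x. (Y x)\<^sup>2"] by (simp add: power2_eq_square)
  next
    case False
    have "prob_space.indep_vars ?P (\<lambda>_. borel) (\<lambda>i xs. Y (xs i)) {i, j}"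
      by (rule prob_space.indep_vars_compose2[OF ps
            prob_space.indep_vars_subset[OF ps indep_vars_Pi_pmf[OF A]]]) (use ij in auto)
    then have "measure_pmf.expectation ?P (\<lambda>xs. \<Prod>l\<in>{i, j}. Y (xs l))
        = (\<Prod>l\<in>{i, j}. measure_pmf.expectation ?P (\<lambda>xs. Y (xs l)))"
      by (intro prob_space.indep_vars_lebesgue_integral ps int1) auto
    then show ?thesis using False Pi_pmf_marginal_expectation[OF A ij(1), of d p Y] 0 by simp
  qed
  have "measure_pmf.expectation ?P (\<lambda>xs. (\<Sum>i\<in>A. Y (xs i))\<^sup>2)
      = measure_pmf.expectation ?P (\<lambda>xs. \<Sum>i\<in>A. \<Sum>j\<in>A. Y (xs i) * Y (xs j))"
    by (simp add: power2_eq_square sum_product)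
  also have "\<dots> = (\<Sum>i\<in>A. \<Sum>j\<in>A. measure_pmf.expectation ?P (\<lambda>xs. Y (xs i) * Y (xs j)))"
    using int by (simp add: Bochner_Integration.integral_sum)
  also have "\<dots> = (\<Sum>i\<in>A. measure_pmf.expectation p (\<lambda>x. (Y x)\<^sup>2))"
    using A by (simp add: cross)
  finally show ?thesis by simp
qed

text \<open>The indicator of \<open>x\<close> has variance \<open>pmf p x * (1 - pmf p x)\<close>,
  and averaging \<open>n\<close> independent copies divides it by \<open>n\<close>.\<close>

lemma expectation_empirical_square_le:
  assumes n: "n > 0"
  shows "measure_pmf.expectation (Pi_pmf {..<n} d (\<lambda>_. p)) (\<lambda>xs. (empirical n xs x - pmf p x)\<^sup>2)
    \<le> pmf p x / real n"
proof -
  let ?P = "Pi_pmf {..<n} d (\<lambda>_. p)"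
  define Y where "Y y = of_bool (y = x) - pmf p x" for y
  have int: "integrable (measure_pmf p) (\<lambda>y. of_bool (y = x) :: real)"
    by (intro measure_pmf.integrable_const_bound[where B = 1]) auto
  have ind: "measure_pmf.expectation p (\<lambda>y. of_bool (y = x)) = pmf p x"
  proof -
    have "(\<lambda>y. of_bool (y = x)) = indicat_real {x}" by (auto simp: fun_eq_iff)
    then show ?thesis by (simp add: measure_pmf_single)
  qed
  have 0: "measure_pmf.expectation p Y = 0"
    unfolding Y_def using int ind by simp
  have "(Y y)\<^sup>2 = (1 - 2 * pmf p x) * of_bool (y = x) + (pmf p x)\<^sup>2" for y
    by (simp add: Y_def power2_diff algebra_simps)
  then have "measure_pmf.expectation p (\<lambda>y. (Y y)\<^sup>2) = (1 - 2 * pmf p x) * pmf p x + (pmf p x)\<^sup>2"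
    using int ind by simp
  also have "\<dots> \<le> pmf p x" by (simp add: power2_eq_square algebra_simps)
  finally have sm: "measure_pmf.expectation p (\<lambda>y. (Y y)\<^sup>2) \<le> pmf p x" .
  have bd: "\<bar>Y y\<bar> \<le> 1" for y
    using pmf_le_1[of p x] by (auto simp: Y_def)
  have "empirical n xs x - pmf p x = (\<Sum>i<n. Y (xs i)) / real n" for xs
    using n by (simp add: empirical_def Y_def sum_subtractf field_simps)
  then have "measure_pmf.expectation ?P (\<lambda>xs. (empirical n xs x - pmf p x)\<^sup>2)
      = measure_pmf.expectation ?P (\<lambda>xs. (\<Sum>i<n. Y (xs i))\<^sup>2) / (real n)\<^sup>2"
    by (simp add: power_divide)
  also have "\<dots> = real n * measure_pmf.expectation p (\<lambda>y. (Y y)\<^sup>2) / (real n)\<^sup>2"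
    using Pi_pmf_sum_second_moment[OF _ bd 0, of "{..<n}" d] by simp
  also have "\<dots> \<le> real n * pmf p x / (real n)\<^sup>2"
    by (intro divide_right_mono mult_left_mono sm) auto
  also have "\<dots> = pmf p x / real n" using n by (simp add: power2_eq_square)
  finally show ?thesis .
qed

text \<open>The default \<open>undefined\<close> is the value of extensional functions outside
  \<open>A\<close>, so the product law lives on exactly the functions over which the risk
  sums.\<close>

lemma nn_integral_count_space_PiE_eq_Pi_pmf:
  assumes "finite A"
  shows "(\<integral>\<^sup>+xs. (\<Prod>i\<in>A. ennreal (pmf p (xs i))) * g xs \<partial>count_space (A \<rightarrow>\<^sub>E UNIV))
    = (\<integral>\<^sup>+xs. g xs \<partial>measure_pmf (Pi_pmf A undefined (\<lambda>_. p)))"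
  unfolding nn_integral_measure_pmf using assms
  by (subst nn_integral_count_space_indicator)
    (auto intro!: nn_integral_cong simp: pmf_Pi prod_ennreal PiE_def extensional_def indicator_def)

section \<open>Truncated risk under a lower bound on the rate\<close>

lemma suminf_ennreal_le_sums:
  fixes f g :: "nat \<Rightarrow> real"
  assumes "\<And>x. 0 \<le> f x" "\<And>x. f x \<le> g x" "g sums s"
  shows "(\<Sum>x. ennreal (f x)) \<le> ennreal s"
proof -
  have "(\<Sum>x. ennreal (f x)) \<le> (\<Sum>x. ennreal (g x))"
    using assms by (intro suminf_le ennreal_leI) auto
  also have "\<dots> = ennreal s"
    using assms by (intro suminf_ennreal_eq) (auto intro: order_trans)
  finally show ?thesis .
qed

text \<open>The first summand is the series controlling the mass of the tail, the second the one
  controlling its quadratic moment; a single constant serves both.\<close>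

definition tail_const :: "real \<Rightarrow> real \<Rightarrow> real" where
  "tail_const k q = (1 - q) powr (- k) + k * (k + 1) * (1 - q) powr (- (k + 2))"

lemma tail_const_nonneg: "k > 0 \<Longrightarrow> tail_const k q \<ge> 0"
  by (simp add: tail_const_def)

text \<open>The geometric ratio \<open>1 / (L + 1)\<close> is written \<open>q * q\<close>: beyond
  \<open>K\<close> one power of \<open>q\<close> yields the small factor \<open>q ^ K\<close>, the
  other keeps the series summable.\<close>

locale bounded_rate_mixture =
  fixes k L q :: real and H :: "ennreal measure"
  assumes k: "k > 0" and L: "L > 0" and q: "q = sqrt (1 / (L + 1))"
    and prob: "prob_space H" and borel: "sets H = sets borel"
    and rate: "AE l in H. ennreal L \<le> l \<and> l \<noteq> \<top>"
begin

abbreviation f where "f \<equiv> mix_pmf k H"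

lemma q_pos: "0 < q" and q_less_1: "q < 1"
  using L by (auto simp: q)

lemma AE_proper: "AE l in H. l \<noteq> 0 \<and> l \<noteq> \<top>"
  using rate by eventually_elim (use L in \<open>auto simp: ennreal_eq_0_iff\<close>)

lemma pos_inf: "prob_on_pos_inf H"
proof -
  have "AE l in H. l \<notin> {0}" using AE_proper by eventually_elim auto
  then have "emeasure H {0} = 0"
    by (subst (asm) AE_iff_measurable[of "{0}"]) (auto simp: borel space_borel sets_eq_imp_space_eq[OF borel])
  then show ?thesis using prob borel by (simp add: prob_on_pos_inf_def)
qed

lemma f_pos: "f x > 0"
  by (rule mix_pmf_pos[OF k prob borel AE_proper])

lemma f_le: "K \<le> x \<Longrightarrow> f x \<le> q ^ K * (pochhammer k x / fact x * q ^ x)"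
proof -
  assume "K \<le> x"
  have "f x \<le> pochhammer k x / fact x * (1 / (L + 1)) ^ x"
    by (rule mix_pmf_le_geometric[OF k L prob borel rate])
  also have "1 / (L + 1) = q * q" using L by (simp add: q)
  also have "pochhammer k x / fact x * (q * q) ^ x = q ^ x * (pochhammer k x / fact x * q ^ x)"
    by (simp add: power_mult_distrib)
  also have "\<dots> \<le> q ^ K * (pochhammer k x / fact x * q ^ x)"
    using q_pos q_less_1 k \<open>K \<le> x\<close>
    by (intro mult_right_mono power_decreasing mult_nonneg_nonneg divide_nonneg_nonneg pochhammer_nonneg) auto
  finally show ?thesis .
qed

text \<open>The total mass 1 is compared termwise with \<open>f\<close> up to \<open>K\<close> plus
  the dominating series over all \<open>x\<close>.\<close>

lemma tail_mass_le: "1 - (\<Sum>x\<le>K. f x) \<le> tail_const k q * q ^ K"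
proof -
  have "(\<lambda>x. pochhammer k x / fact x * q ^ x) sums (1 - q) powr (- k)"
    using q_pos q_less_1 by (intro pochhammer_series) auto
  then have bound: "(\<lambda>x. (if x \<in> {..K} then f x else 0) + q ^ K * (pochhammer k x / fact x * q ^ x)) sums
      ((\<Sum>x\<le>K. f x) + q ^ K * (1 - q) powr (- k))"
    by (intro sums_add sums_mult sums_If_finite_set) auto
  have "f x \<le> (if x \<in> {..K} then f x else 0) + q ^ K * (pochhammer k x / fact x * q ^ x)" for x
    using f_le[of K x] q_pos k by (auto intro!: mult_nonneg_nonneg divide_nonneg_nonneg pochhammer_nonneg)
  then have "1 \<le> (\<Sum>x\<le>K. f x) + q ^ K * (1 - q) powr (- k)"
    by (rule sums_le[OF _ mix_pmf_sums[OF k pos_inf] bound])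
  moreover have "q ^ K * (1 - q) powr (- k) \<le> q ^ K * tail_const k q"
    using q_pos k by (intro mult_left_mono) (auto simp: tail_const_def)
  ultimately show ?thesis by (simp add: mult.commute)
qed

text \<open>From \<open>K\<close> on, both posterior means lie in \<open>[0, x + k]\<close>, and the
  weight \<open>(x + k)^2\<close> is absorbed by shifting the shape to \<open>k + 2\<close>. For
  \<open>K = 0\<close> this bounds the entire regret by a constant.\<close>

lemma regret_truncate:
  assumes G: "prob_space G" "sets G = sets borel"
  shows "(\<integral>\<^sup>+x. ennreal (f x) * ennreal ((post_mean k G x - post_mean k H x)\<^sup>2) \<partial>count_space UNIV)
    \<le> ennreal ((\<Sum>x<K. f x * (post_mean k G x - post_mean k H x)\<^sup>2) + tail_const k q * q ^ K)"
proof -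
  define d where "d x = (post_mean k G x - post_mean k H x)\<^sup>2" for x
  define g where "g x = k * (k + 1) * (pochhammer (k + 2) x / fact x * q ^ x)" for x
  have g0: "g x \<ge> 0" for x
    unfolding g_def using k q_pos
    by (intro mult_nonneg_nonneg divide_nonneg_nonneg pochhammer_nonneg) auto
  have tail: "f x * d x \<le> q ^ K * g x" if "K \<le> x" for x
  proof -
    have "\<bar>post_mean k G x - post_mean k H x\<bar> \<le> real x + k"
      using post_mean_bounds[OF k G, of x] post_mean_bounds[OF k prob borel, of x] by auto
    then have "d x \<le> (real x + k)\<^sup>2"
      unfolding d_def by (rule power2_le_iff_abs_le[THEN iffD2, rotated]) (use k in simp)
    also have "\<dots> \<le> (k + real x) * (k + real x + 1)"
      using k by (simp add: power2_eq_square algebra_simps)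
    finally have "f x * d x \<le> (q ^ K * (pochhammer k x / fact x * q ^ x)) * ((k + real x) * (k + real x + 1))"
      using f_le[OF that] f_pos[of x] by (intro mult_mono) (auto simp: d_def)
    also have "\<dots> = q ^ K * ((k + real x) * (k + real x + 1) * pochhammer k x / fact x * q ^ x)"
      by (simp add: mult_ac)
    also have "\<dots> = q ^ K * g x"
      unfolding pochhammer_shift_two g_def by simp
    finally show ?thesis .
  qed
  have "(\<lambda>x. (if x \<in> {..<K} then f x * d x else 0) + q ^ K * g x) sums
      ((\<Sum>x<K. f x * d x) + q ^ K * (k * (k + 1) * (1 - q) powr (- (k + 2))))"
    unfolding g_def using q_pos q_less_1
    by (intro sums_add sums_mult sums_If_finite_set pochhammer_series) auto
  moreover have "f x * d x \<le> (if x \<in> {..<K} then f x * d x else 0) + q ^ K * g x" for x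
    using tail[of x] g0[of x] q_pos by (cases "x < K") auto
  ultimately have "(\<Sum>x. ennreal (f x * d x)) \<le>
      ennreal ((\<Sum>x<K. f x * d x) + q ^ K * (k * (k + 1) * (1 - q) powr (- (k + 2))))"
    using f_pos by (intro suminf_ennreal_le_sums) (auto simp: d_def less_imp_le)
  also have "\<dots> \<le> ennreal ((\<Sum>x<K. f x * d x) + tail_const k q * q ^ K)"
    using q_pos k by (intro ennreal_leI) (simp add: tail_const_def algebra_simps)
  finally show ?thesis
    using f_pos by (simp add: nn_integral_count_space_nat d_def ennreal_mult less_imp_le)
qed

text \<open>The regret at \<open>x\<close> involves the masses at \<open>x\<close> and
  \<open>x + 1\<close>. Hence \<open>x < K\<close> stays within \<open>{..K}\<close> and uses each
  Hellinger term at most twice, which doubles 16 to 32.\<close>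

lemma regret_le_hellinger:
  assumes G: "prob_space G" "sets G = sets borel"
  shows "(\<Sum>x<K. f x * (post_mean k G x - post_mean k H x)\<^sup>2)
    \<le> 32 * (real K + k)\<^sup>2 * (\<Sum>x\<le>K. (sqrt (mix_pmf k G x) - sqrt (f x))\<^sup>2)"
proof -
  define h where "h x = (sqrt (mix_pmf k G x) - sqrt (f x))\<^sup>2" for x
  have h0: "h x \<ge> 0" for x by (simp add: h_def)
  have "f x * (post_mean k G x - post_mean k H x)\<^sup>2 \<le> 16 * (real K + k)\<^sup>2 * (h (Suc x) + h x)"
    if "x < K" for x
  proof -
    have "f x * (post_mean k G x - post_mean k H x)\<^sup>2
        \<le> 16 * ((real x + 1) * (real x + k) * h (Suc x) + (real x + k)\<^sup>2 * h x)"
      unfolding post_mean_eq[OF k] h_def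
      using mix_pmf_Suc_le[OF k G, of x] mix_pmf_Suc_le[OF k prob borel, of x]
      by (intro regret_pointwise_le f_pos mix_pmf_nonneg k) auto
    also have "\<dots> \<le> 16 * ((real K + k) * (real K + k) * h (Suc x) + (real K + k)\<^sup>2 * h x)"
    proof -
      \<comment> \<open>Strictness of \<open>x < K\<close> gives \<open>x + 1 \<le> K\<close>, which
        covers the case \<open>k < 1\<close> as well.\<close>
      have le: "real x + 1 \<le> real K + k" "real x + k \<le> real K + k" using that k by linarith+
      have "(real x + 1) * (real x + k) \<le> (real K + k) * (real K + k)"
        using k by (intro mult_mono[OF le]) auto
      moreover have "(real x + k)\<^sup>2 \<le> (real K + k)\<^sup>2"
        using k by (intro power_mono[OF le(2)]) auto
      ultimately show ?thesis
        by (intro mult_left_mono add_mono mult_right_mono h0) simp_all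
    qed
    finally show ?thesis by (simp add: power2_eq_square algebra_simps)
  qed
  then have "(\<Sum>x<K. f x * (post_mean k G x - post_mean k H x)\<^sup>2)
      \<le> (\<Sum>x<K. 16 * (real K + k)\<^sup>2 * (h (Suc x) + h x))"
    by (intro sum_mono) auto
  also have "\<dots> = 16 * (real K + k)\<^sup>2 * ((\<Sum>x<K. h (Suc x)) + (\<Sum>x<K. h x))"
    by (simp add: sum.distrib flip: sum_distrib_left)
  also have "\<dots> \<le> 16 * (real K + k)\<^sup>2 * ((\<Sum>x\<le>K. h x) + (\<Sum>x\<le>K. h x))"
  proof (intro mult_left_mono add_mono)
    show "(\<Sum>x<K. h (Suc x)) \<le> (\<Sum>x\<le>K. h x)"
      using h0 by (simp add: sum.atMost_shift)
    show "(\<Sum>x<K. h x) \<le> (\<Sum>x\<le>K. h x)"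
      using h0 by (intro sum_mono2) auto
  qed auto
  finally show ?thesis by (simp add: h_def)
qed

section \<open>Expected risk over the sample\<close>

definition p :: "nat pmf" where "p = embed_pmf f"

lemma pmf_p: "pmf p x = f x"
  unfolding p_def
proof (rule pmf_embed_pmf)
  show "0 \<le> f x" for x by (rule mix_pmf_nonneg[OF k])
  show "(\<integral>\<^sup>+x. ennreal (f x) \<partial>count_space UNIV) = 1"
    using suminf_ennreal_eq[OF mix_pmf_nonneg[OF k] mix_pmf_sums[OF k pos_inf]]
    by (simp add: nn_integral_count_space_nat)
qed

lemma expectation_exceed_le:
  "measure_pmf.expectation p (\<lambda>y. of_bool (K < y)) \<le> tail_const k q * q ^ K"
proof -
  have "measure_pmf.expectation p (\<lambda>y. of_bool (K < y))
      = measure_pmf.expectation p (indicat_real (UNIV - {..K}))"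
    by (intro Bochner_Integration.integral_cong) (auto simp: indicator_def)
  also have "\<dots> = measure_pmf.prob p (UNIV - {..K})" by simp
  also have "\<dots> = 1 - measure_pmf.prob p {..K}"
    using measure_pmf.prob_compl[of "{..K}" p] by simp
  also have "\<dots> = 1 - (\<Sum>x\<le>K. f x)"
    by (simp add: measure_measure_pmf_finite pmf_p)
  finally show ?thesis using tail_mass_le[of K] by simp
qed

text \<open>If the sample stays below the cutoff, the Hellinger bound applies; otherwise the crude
  constant bound on the regret is charged to the number of exceedances, whose mean is at most
  \<open>n * D * q ^ K\<close>.\<close>

lemma npmle_risk_le:
  assumes n: "n > 0" and Hhat: "\<forall>xs \<in> {..<n} \<rightarrow>\<^sub>E (UNIV :: nat set). is_npmle k n xs (Hhat xs)"
  defines "D \<equiv> tail_const k q"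
  shows "npmle_risk k n H Hhat \<le> ennreal (32 * (real K + k)\<^sup>2 * (4 * (real K + 1) / real n + 2 * (D * q ^ K))
      + D * q ^ K + D * (real n * (D * q ^ K)))"
proof -
  let ?P = "Pi_pmf {..<n} undefined (\<lambda>_. p)"
  let ?M = "32 * (real K + k)\<^sup>2"
  let ?regret = "\<lambda>xs. \<integral>\<^sup>+x. ennreal (f x) * ennreal ((post_mean k (Hhat xs) x - post_mean k H x)\<^sup>2)
      \<partial>count_space UNIV"
  define chi where "chi xs = (\<Sum>x\<le>K. (empirical n xs x - f x)\<^sup>2 / f x)" for xs
  define N where "N xs = (\<Sum>i<n. of_bool (K < xs i) :: real)" for xs :: "nat \<Rightarrow> nat"
  \<comment> \<open>One majorant for both cases. It is free of \<open>Hhat\<close> and affine in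
    \<open>chi\<close> and \<open>N\<close>, so its expectation is explicit.\<close>
  define Phi where "Phi xs = ?M * (4 * chi xs + 2 * (D * q ^ K)) + D * q ^ K + D * N xs" for xs
  have D: "D \<ge> 0" unfolding D_def by (rule tail_const_nonneg[OF k])
  have chi0: "chi xs \<ge> 0" for xs
    unfolding chi_def using f_pos by (intro sum_nonneg divide_nonneg_pos) auto
  have N0: "N xs \<ge> 0" for xs unfolding N_def by (intro sum_nonneg) auto
  have Phi0: "Phi xs \<ge> 0" for xs
    unfolding Phi_def using D chi0 N0 q_pos
    by (intro add_nonneg_nonneg mult_nonneg_nonneg) auto
  have regret: "?regret xs \<le> ennreal (Phi xs)" if xs: "xs \<in> {..<n} \<rightarrow>\<^sub>E UNIV" for xs
  proof -
    have npmle: "is_npmle k n xs (Hhat xs)" using Hhat xs by blast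
    then have G: "prob_space (Hhat xs)" "sets (Hhat xs) = sets borel"
      by (auto simp: is_npmle_def prob_on_pos_inf_def)
    show ?thesis
    proof (cases "\<forall>i<n. xs i \<le> K")
      case True
      have "(\<Sum>x\<le>K. (sqrt (mix_pmf k (Hhat xs) x) - sqrt (f x))\<^sup>2) \<le> 4 * chi xs + 2 * (1 - (\<Sum>x\<le>K. f x))"
        unfolding chi_def using True by (intro npmle_hellinger_le k n npmle pos_inf f_pos) auto
      also have "\<dots> \<le> 4 * chi xs + 2 * (D * q ^ K)"
        using tail_mass_le[of K] by (simp add: D_def)
      finally have "(\<Sum>x<K. f x * (post_mean k (Hhat xs) x - post_mean k H x)\<^sup>2)
          \<le> ?M * (4 * chi xs + 2 * (D * q ^ K))"
        by (intro order_trans[OF regret_le_hellinger[OF G]] mult_left_mono) auto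
      then have "(\<Sum>x<K. f x * (post_mean k (Hhat xs) x - post_mean k H x)\<^sup>2) + D * q ^ K \<le> Phi xs"
        unfolding Phi_def using mult_nonneg_nonneg[OF D N0[of xs]] by linarith
      then show ?thesis
        using order_trans[OF regret_truncate[OF G, of K] ennreal_leI] by (simp add: D_def)
    next
      case False
      \<comment> \<open>Now \<open>N xs \<ge> 1\<close>, so \<open>D * N xs\<close> alone dominates
        the regret, which truncation at 0 bounds by \<open>D\<close>.\<close>
      then obtain j where j: "j < n" "K < xs j" by (auto simp: not_le)
      have "1 = (\<Sum>i\<in>{j}. of_bool (K < xs i) :: real)" using j by simp
      also have "\<dots> \<le> N xs" unfolding N_def using j by (intro sum_mono2) auto
      finally have "D * 1 \<le> D * N xs" using D by (intro mult_left_mono) auto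
      moreover have "0 \<le> ?M * (4 * chi xs + 2 * (D * q ^ K)) + D * q ^ K"
        using D chi0 q_pos by (intro add_nonneg_nonneg mult_nonneg_nonneg) auto
      ultimately have "D \<le> Phi xs" unfolding Phi_def by linarith
      then show ?thesis
        using order_trans[OF regret_truncate[OF G, of 0] ennreal_leI] by (simp add: D_def)
    qed
  qed
  have emp: "0 \<le> empirical n xs x" "empirical n xs x \<le> 1" for xs x
    using sum_bounded_above[of "{..<n}" "\<lambda>i. of_bool (xs i = x) :: real" 1] n
    by (auto simp: empirical_def simp del: sum_of_bool_eq intro!: divide_nonneg_nonneg sum_nonneg)
  have int_sq: "integrable (measure_pmf ?P) (\<lambda>xs. (empirical n xs x - f x)\<^sup>2)" for x
  proof (intro measure_pmf.integrable_const_bound[where B = 1] AE_I2)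
    fix xs
    have "\<bar>empirical n xs x - f x\<bar> \<le> 1"
      using emp[of xs x] f_pos[of x] pmf_le_1[of p x] by (auto simp: pmf_p)
    then show "norm ((empirical n xs x - f x)\<^sup>2) \<le> 1" by (simp add: abs_square_le_1)
  qed auto
  have int_ind: "integrable (measure_pmf ?P) (\<lambda>xs. of_bool (K < xs i) :: real)" for i
    by (intro measure_pmf.integrable_const_bound[where B = 1]) auto
  have int_chi: "integrable (measure_pmf ?P) chi"
    unfolding chi_def by (intro Bochner_Integration.integrable_sum integrable_divide int_sq)
  have int_N: "integrable (measure_pmf ?P) N"
    unfolding N_def by (intro Bochner_Integration.integrable_sum int_ind)
  have int_Phi: "integrable (measure_pmf ?P) Phi"
    unfolding Phi_def
    by (intro Bochner_Integration.integrable_add integrable_mult_right int_chi int_N) auto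
  have "measure_pmf.expectation ?P chi
      = (\<Sum>x\<le>K. measure_pmf.expectation ?P (\<lambda>xs. (empirical n xs x - f x)\<^sup>2) / f x)"
    unfolding chi_def using int_sq by (simp add: Bochner_Integration.integral_sum)
  \<comment> \<open>The chi-square weight \<open>1 / f x\<close> cancels the variance bound
    \<open>f x / n\<close>, leaving \<open>1 / n\<close> for each of the \<open>K + 1\<close>
    cells.\<close>
  also have "\<dots> \<le> (\<Sum>x\<le>K. (f x / real n) / f x)"
    using expectation_empirical_square_le[OF n, of undefined p] f_pos
    by (intro sum_mono divide_right_mono) (auto simp: pmf_p less_imp_le)
  also have "\<dots> = (\<Sum>x\<le>K. 1 / real n)"
    using f_pos by (intro sum.cong refl) (simp add: less_imp_neq[symmetric])
  finally have E_chi: "measure_pmf.expectation ?P chi \<le> (real K + 1) / real n"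
    by (simp add: add.commute)
  have "measure_pmf.expectation ?P N
      = (\<Sum>i<n. measure_pmf.expectation ?P (\<lambda>xs. of_bool (K < xs i)))"
    unfolding N_def using int_ind by (intro Bochner_Integration.integral_sum) auto
  also have "\<dots> = (\<Sum>i<n. measure_pmf.expectation p (\<lambda>y. of_bool (K < y)))"
    by (intro sum.cong refl Pi_pmf_marginal_expectation[where g = "\<lambda>y. of_bool (K < y)"]) auto
  also have "\<dots> \<le> real n * (D * q ^ K)"
    using expectation_exceed_le[of K] by (simp add: D_def mult_left_mono)
  finally have E_N: "measure_pmf.expectation ?P N \<le> real n * (D * q ^ K)" .
  have "npmle_risk k n H Hhat
      = (\<integral>\<^sup>+xs. (\<Prod>i<n. ennreal (pmf p (xs i))) * ?regret xs \<partial>count_space ({..<n} \<rightarrow>\<^sub>E UNIV))"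
    by (simp add: npmle_risk_def pmf_p)
  also have "\<dots> \<le> (\<integral>\<^sup>+xs. (\<Prod>i<n. ennreal (pmf p (xs i))) * ennreal (Phi xs) \<partial>count_space ({..<n} \<rightarrow>\<^sub>E UNIV))"
    by (intro nn_integral_mono mult_left_mono regret) auto
  also have "\<dots> = (\<integral>\<^sup>+xs. ennreal (Phi xs) \<partial>measure_pmf ?P)"
    by (intro nn_integral_count_space_PiE_eq_Pi_pmf) auto
  also have "\<dots> = ennreal (measure_pmf.expectation ?P Phi)"
    by (intro nn_integral_eq_integral int_Phi) (simp add: Phi0)
  also have "measure_pmf.expectation ?P Phi
      = ?M * (4 * measure_pmf.expectation ?P chi + 2 * (D * q ^ K)) + D * q ^ K
        + D * measure_pmf.expectation ?P N"
    unfolding Phi_def using int_chi int_N by simp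
  also have "ennreal \<dots> \<le> ennreal (?M * (4 * ((real K + 1) / real n) + 2 * (D * q ^ K)) + D * q ^ K
        + D * (real n * (D * q ^ K)))"
    using E_chi E_N D by (intro ennreal_leI add_mono mult_left_mono order_refl) auto
  finally show ?thesis by simp
qed

end

section \<open>Logarithmic cutoff and the final rate\<close>

lemma rate_bound:
  fixes c D E k q :: real and n K :: nat
  assumes n: "n \<ge> 2" and "D \<ge> 0" "k > 0" "c > 0" and E: "E = c + 4 + 2 * k"
    and K: "real K \<le> c * ln (real n) + 1" and q: "q ^ K \<le> 1 / (real n)\<^sup>2"
  shows "32 * (real K + k)\<^sup>2 * (4 * (real K + 1) / real n + 2 * (D * q ^ K))
      + D * q ^ K + D * (real n * (D * q ^ K))
    \<le> (128 * E ^ 3 + 128 * E\<^sup>2 * D + 8 * D + 8 * D\<^sup>2) * ln (real n) ^ 3 / real n"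
proof -
  define l where "l = ln (real n)"
  \<comment> \<open>From \<open>n \<ge> 2\<close> comes \<open>1 \<le> 2 * l\<close>, which lets
    additive constants be absorbed into powers of \<open>l\<close>.\<close>
  have "1 / 2 \<le> ln (2 :: real)" using ln2_ge_two_thirds by simp
  also have "\<dots> \<le> l" unfolding l_def using n by simp
  finally have l: "1 \<le> 2 * l" by simp
  have E0: "E > 0" using assms by simp
  have kl: "k \<le> k * (2 * l)" using l assms by simp
  have b1: "real K + k \<le> E * l" and b2: "real K + 1 \<le> E * l"
  proof -
    \<comment> \<open>In \<open>E\<close>, the part \<open>c\<close> covers the growth of
      \<open>K\<close>, the 4 covers additive constants up to 2, and \<open>2 * k\<close> covers the
      shape.\<close>
    have "E * l = c * l + 4 * l + k * (2 * l)" by (simp add: E algebra_simps)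
    with K kl l \<open>k > 0\<close> show "real K + k \<le> E * l" "real K + 1 \<le> E * l"
      unfolding l_def[symmetric] by linarith+
  qed
  have l3: "1 \<le> 8 * l ^ 3" using power_mono[OF l, of 3] by (simp add: power_mult_distrib)
  have l2: "l\<^sup>2 \<le> 2 * l ^ 3"
    using mult_right_mono[OF l, of "l\<^sup>2"] by (simp add: power2_eq_square power3_eq_cube)
  have q1: "q ^ K \<le> 1 / real n"
    using q n by (intro order_trans[OF q]) (simp add: power2_eq_square field_simps)
  \<comment> \<open>One of the two factors \<open>1 / n\<close> pays for the number of observations
    in the expected count of exceedances.\<close>
  have q2: "real n * q ^ K \<le> 1 / real n"
    using mult_left_mono[OF q, of "real n"] n by (simp add: power2_eq_square)
  have "32 * (real K + k)\<^sup>2 * (4 * (real K + 1) / real n + 2 * (D * q ^ K))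
      + D * q ^ K + D * (real n * (D * q ^ K))
     = 32 * (real K + k)\<^sup>2 * (4 * (real K + 1) / real n) + 64 * D * (real K + k)\<^sup>2 * q ^ K
      + D * q ^ K + D\<^sup>2 * (real n * q ^ K)"
    by (simp add: algebra_simps power2_eq_square)
  also have "\<dots> \<le> 32 * (E * l)\<^sup>2 * (4 * (E * l) / real n) + 64 * D * (real K + k)\<^sup>2 * (1 / real n)
      + D * (1 / real n) + D\<^sup>2 * (1 / real n)"
    using b1 b2 q1 q2 assms(2,3)
    by (intro add_mono mult_mono mult_left_mono divide_right_mono power_mono) auto
  also have "\<dots> \<le> 32 * (E * l)\<^sup>2 * (4 * (E * l) / real n) + 64 * D * (E * l)\<^sup>2 * (1 / real n)
      + D * (1 / real n) + D\<^sup>2 * (1 / real n)"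
    using b1 assms(2,3) by (intro add_mono mult_mono mult_left_mono power_mono order_refl) auto
  also have "\<dots> = (128 * E ^ 3 * l ^ 3 + 64 * E\<^sup>2 * D * l\<^sup>2 + D * 1 + D\<^sup>2 * 1) / real n"
    using n by (simp add: field_simps power2_eq_square power3_eq_cube)
  \<comment> \<open>All lower powers of \<open>l\<close> are raised to \<open>l ^ 3\<close>.\<close>
  also have "\<dots> \<le> (128 * E ^ 3 * l ^ 3 + 64 * E\<^sup>2 * D * (2 * l ^ 3) + D * (8 * l ^ 3) + D\<^sup>2 * (8 * l ^ 3)) / real n"
    using l2 l3 assms(2) E0 by (intro divide_right_mono add_mono mult_left_mono order_refl) auto
  finally show ?thesis by (simp add: l_def algebra_simps)
qed

theorem theorem3p2:
  fixes k L :: real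
  assumes "k > 0" and "L > 0"
  shows "\<exists>C>0. \<forall>(n::nat) (Hs::ennreal measure) (Hhat::(nat \<Rightarrow> nat) \<Rightarrow> ennreal measure).
           n \<ge> 2
           \<and> prob_space Hs \<and> sets Hs = sets borel
           \<and> (AE l in Hs. ennreal L \<le> l \<and> l \<noteq> \<top>)
           \<and> (\<forall>xs \<in> {..<n} \<rightarrow>\<^sub>E (UNIV :: nat set). is_npmle k n xs (Hhat xs))
           \<longrightarrow> npmle_risk k n Hs Hhat \<le> ennreal (C * (ln (real n)) ^ 3 / real n)"
proof -
  define q where "q = sqrt (1 / (L + 1))"
  have q01: "0 < q" "q < 1" using assms by (auto simp: q_def)
  \<comment> \<open>Chosen so that \<open>q powr (c * ln n)\<close> equals
    \<open>1 / n^2\<close>.\<close>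
  define c where "c = - 2 / ln q"
  have ln_q: "ln q < 0" using q01 by simp
  have c: "c > 0" using ln_q by (simp add: c_def divide_neg_neg)
  define D where "D = tail_const k q"
  have D: "D \<ge> 0" unfolding D_def by (rule tail_const_nonneg[OF assms(1)])
  define E where "E = c + 4 + 2 * k"
  have E: "E > 0" using c assms by (simp add: E_def)
  \<comment> \<open>All ingredients are fixed by \<open>k\<close> and \<open>L\<close> before
    \<open>n\<close>, \<open>Hs\<close> and \<open>Hhat\<close> enter.\<close>
  define C where "C = 128 * E ^ 3 + 128 * E\<^sup>2 * D + 8 * D + 8 * D\<^sup>2"
  have "C > 0" unfolding C_def using E D by (intro add_pos_nonneg mult_pos_pos) auto
  moreover have "npmle_risk k n Hs Hhat \<le> ennreal (C * ln (real n) ^ 3 / real n)"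
    if n: "n \<ge> 2" and Hs: "prob_space Hs" "sets Hs = sets borel" "AE l in Hs. ennreal L \<le> l \<and> l \<noteq> \<top>"
      and Hhat: "\<forall>xs \<in> {..<n} \<rightarrow>\<^sub>E (UNIV :: nat set). is_npmle k n xs (Hhat xs)"
    for n Hs Hhat
  proof -
    interpret bounded_rate_mixture k L q Hs
      by (intro bounded_rate_mixture.intro assms q_def Hs)
    \<comment> \<open>Rounding up preserves the decay of \<open>q ^ K\<close> and costs at most 1 in
      the size of \<open>K\<close>.\<close>
    define K where "K = nat \<lceil>c * ln (real n)\<rceil>"
    have "0 \<le> c * ln (real n)" using c n by simp
    then have K1: "c * ln (real n) \<le> real K" and K2: "real K \<le> c * ln (real n) + 1"
      unfolding K_def by linarith+
    have "q ^ K = exp (real K * ln q)" by (simp only: exp_of_nat_mult exp_ln[OF q01(1)])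
    also have "\<dots> \<le> exp (c * ln (real n) * ln q)"
      using K1 ln_q by (simp add: mult_right_mono_neg)
    also have "c * ln (real n) * ln q = - (2 * ln (real n))"
      using ln_q by (simp add: c_def)
    also have "exp \<dots> = 1 / (real n)\<^sup>2"
      using n by (simp add: exp_minus exp_double inverse_eq_divide)
    finally have qK: "q ^ K \<le> 1 / (real n)\<^sup>2" .
    show ?thesis
      using rate_bound[OF n D assms(1) c E_def K2 qK] n
      by (intro order_trans[OF npmle_risk_le[OF _ Hhat, of K]] ennreal_leI) (auto simp: C_def D_def)
  qed
  ultimately show ?thesis by blast
qed

end
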